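(* Let $N\ge 1$, $n\ge1$ be integers and $\mu,\lambda\in\{1,-1\}$. The $(2n+1)$-dimensional simple Yetter-Drinfeld module $\mathscr{L}_{k,pq}^s$ over the Suzuki algebra $A_{N\,2n+1}^{\mu\lambda}$, whose braiding is associated to the set-theoretical solution $(X,r)$ of the Yang-Baxter equation given in the context, is of dihedral rack type $\mathbb{D}_{2n+1}$.
   Context: $\Bbbk$ is an algebraically closed field of characteristic $0$. The braided vector space $\mathscr{L}_{k,pq}^s$ has a basis $(w_a)_{a\in X}$, $X=\{1,\dots,2n+1\}$, and its braiding is associated to $(X,r)$: $c(w_a\otimes w_b)=R_{a,b}\,w_x\otimes w_y$ where $(x,y)=r(a,b)$ and the $R_{a,b}\in\Bbbk^\times$ are scalars (depending on the indices $k,p,q,s$). Here $r:X\times X\to X\times X$ is: (1) If $a+b$ is odd, write $b+(2a-1)=d_1(2n+1)+d_0$ with $d_1\in\mathbb{N}$ (nonnegative integers), $d_0\in\{0,\dots,2n\}$. Then $r(a,b)$ is $(b+2a-1,a)$ if $d_1=0$; $(2n+1,a)$ if $d_1=1,d_0=0$; $(2n+2-d_0,a)$ if $d_1=1,d_0\ne0$; $(1,a)$ if $d_1=2,d_0=0$; $(d_0,a)$ if $d_1=2,d_0\ne0$. (2) If $a+b$ is even, then $r(a,b)=(b-2a+1,a)$ if $2a-1<b$; otherwise write $2a-1=b+d_1(2n+1)+d_0$ with $d_1\in\mathbb{N}$, $d_0\in\{0,\dots,2n\}$, and $r(a,b)$ is $(2a-b,a)$ if $d_1=0$ and $(2n+1-d_0,a)$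 if $d_1=1$. The dihedral rack is $\mathbb{D}_m=(\mathbb{Z}_m,\rhd)$ with $i\rhd j=2i-j$. A braided vector space is of dihedral rack type $\mathbb{D}_m$ if it has a basis $(u_i)_{i\in\mathbb{Z}_m}$ with $c(u_i\otimes u_j)=R'_{i,j}\,u_{i\rhd j}\otimes u_i$, $R'_{i,j}\in\Bbbk^\times$; for a braiding associated to $(X,r)$ this means that $(X,r)$ is isomorphic (via a bijection $X\to\mathbb{Z}_m$) to the solution $(i,j)\mapsto(i\rhd j,i)$. *)

theory Defs
  imports
    "HOL-Library.Poly_Mapping"
    "HOL-Computational_Algebra.Computational_Algebra"
begin

section \<open>Tensor products over a field\<close>

text \<open>
  A tensor \<open>\<Sum>\<^sub>i v\<^sub>i \<otimes> w\<^sub>i\<close> in \<open>V \<otimes> W\<close> is encoded as the functional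
  \<open>f \<mapsto> \<Sum>\<^sub>i f(v\<^sub>i, w\<^sub>i)\<close> on the bilinear forms \<open>f\<close> on \<open>V \<times> W\<close>. Over a field the
  canonical map from \<open>V \<otimes> W\<close> to these functionals is injective, so this is a model of the
  tensor product, and two tensors are equal iff all bilinear forms agree on them.
  On functions that are not bilinear forms the functional is \<open>0\<close> by convention.
  Applying a tensor \<open>t\<close> to an abstraction \<open>\<lambda>a b. f a b\<close> thus plays the role of
  Sweedler notation \<open>\<Sum> f(t\<^sub>1, t\<^sub>2)\<close>.
\<close>

type_synonym ('v, 'w, 'k) tensor = "('v \<Rightarrow> 'w \<Rightarrow> 'k) \<Rightarrow> 'k"

definition linear_form :: "('k::field \<Rightarrow> 'v::ab_group_add \<Rightarrow> 'v) \<Rightarrow> ('v \<Rightarrow> 'k) \<Rightarrow> bool" where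
  "linear_form s f \<longleftrightarrow> Vector_Spaces.linear s (*) f"

definition bilinear_form ::
  "('k::field \<Rightarrow> 'v::ab_group_add \<Rightarrow> 'v) \<Rightarrow> ('k \<Rightarrow> 'w::ab_group_add \<Rightarrow> 'w) \<Rightarrow> ('v \<Rightarrow> 'w \<Rightarrow> 'k) \<Rightarrow> bool" where
  "bilinear_form s1 s2 f \<longleftrightarrow>
     (\<forall>w. linear_form s1 (\<lambda>v. f v w)) \<and> (\<forall>v. linear_form s2 (\<lambda>w. f v w))"

definition trilinear_form ::
  "('k::field \<Rightarrow> 'u::ab_group_add \<Rightarrow> 'u) \<Rightarrow> ('k \<Rightarrow> 'v::ab_group_add \<Rightarrow> 'v) \<Rightarrow>
   ('k \<Rightarrow> 'w::ab_group_add \<Rightarrow> 'w) \<Rightarrow> ('u \<Rightarrow> 'v \<Rightarrow> 'w \<Rightarrow> 'k) \<Rightarrow> bool" where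
  "trilinear_form s1 s2 s3 f \<longleftrightarrow>
     (\<forall>v w. linear_form s1 (\<lambda>u. f u v w)) \<and> (\<forall>u w. linear_form s2 (\<lambda>v. f u v w)) \<and>
     (\<forall>u v. linear_form s3 (\<lambda>w. f u v w))"

definition tens ::
  "('k::field \<Rightarrow> 'v::ab_group_add \<Rightarrow> 'v) \<Rightarrow> ('k \<Rightarrow> 'w::ab_group_add \<Rightarrow> 'w) \<Rightarrow> 'v \<Rightarrow> 'w \<Rightarrow> ('v, 'w, 'k) tensor" where
  "tens s1 s2 v w = (\<lambda>f. if bilinear_form s1 s2 f then f v w else 0)"

definition tensor_scale :: "'k::field \<Rightarrow> ('v, 'w, 'k) tensor \<Rightarrow> ('v, 'w, 'k) tensor" where
  "tensor_scale r t = (\<lambda>f. r * t f)"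

text \<open>For subspaces \<open>A\<close>, \<open>B\<close> the following is the image of \<open>A \<otimes> B\<close> in the ambient tensor product.\<close>

definition tensor_space ::
  "('k::field \<Rightarrow> 'v::ab_group_add \<Rightarrow> 'v) \<Rightarrow> ('k \<Rightarrow> 'w::ab_group_add \<Rightarrow> 'w) \<Rightarrow> 'v set \<Rightarrow> 'w set \<Rightarrow> ('v, 'w, 'k) tensor set" where
  "tensor_space s1 s2 A B =
     {(\<lambda>f. \<Sum>i<m. tens s1 s2 (a i) (b i) f) |(m::nat) a b. (\<forall>i<m. a i \<in> A \<and> b i \<in> B)}"


section \<open>Hopf algebras and Yetter-Drinfeld modules\<close>

text \<open>
  Identities between vectors (counit, antipode) are stated by applying an arbitrary linear form;
  linear forms separate the points of a vector space.
\<close>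

locale hopf_algebra = vector_space scale
  for scale :: "'k::field \<Rightarrow> 'h::ring_1 \<Rightarrow> 'h" +
  fixes \<Delta> :: "'h \<Rightarrow> ('h, 'h, 'k) tensor"
    and \<epsilon> :: "'h \<Rightarrow> 'k"
    and S :: "'h \<Rightarrow> 'h"
  assumes scale_mult_left: "scale r a * b = scale r (a * b)"
    and scale_mult_right: "a * scale r b = scale r (a * b)"
    and comult_in: "\<Delta> a \<in> tensor_space scale scale UNIV UNIV"
    and comult_linear: "linear_form scale (\<lambda>a. \<Delta> a f)"
    and counit_linear: "linear_form scale \<epsilon>"
    and antipode_linear: "Vector_Spaces.linear scale scale S"
    and coassoc: "trilinear_form scale scale scale F \<Longrightarrow>
          \<Delta> a (\<lambda>b c. \<Delta> b (\<lambda>b1 b2. F b1 b2 c)) = \<Delta> a (\<lambda>b c. \<Delta> c (\<lambda>c1 c2. F b c1 c2))"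
    and counit_left: "linear_form scale g \<Longrightarrow> \<Delta> a (\<lambda>b c. \<epsilon> b * g c) = g a"
    and counit_right: "linear_form scale g \<Longrightarrow> \<Delta> a (\<lambda>b c. g b * \<epsilon> c) = g a"
    and comult_one: "\<Delta> 1 = tens scale scale 1 1"
    and comult_mult: "bilinear_form scale scale f \<Longrightarrow>
          \<Delta> (a * b) f = \<Delta> a (\<lambda>a1 a2. \<Delta> b (\<lambda>b1 b2. f (a1 * b1) (a2 * b2)))"
    and counit_one: "\<epsilon> 1 = 1"
    and counit_mult: "\<epsilon> (a * b) = \<epsilon> a * \<epsilon> b"
    and antipode_left: "linear_form scale g \<Longrightarrow> \<Delta> a (\<lambda>a1 a2. g (S a1 * a2)) = \<epsilon> a * g 1"
    and antipode_right: "linear_form scale g \<Longrightarrow> \<Delta> a (\<lambda>a1 a2. g (a1 * S a2)) = \<epsilon> a * g 1"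

text \<open>
  Left-left Yetter-Drinfeld modules: \<open>\<delta>(h v) = h\<^sub>1 v\<^bsub>-1\<^esub> S(h\<^sub>3) \<otimes> h\<^sub>2 v\<^sub>0\<close>.
\<close>

locale yetter_drinfeld_module =
  hopf_algebra scale \<Delta> \<epsilon> S + V: vector_space scaleV
  for scale :: "'k::field \<Rightarrow> 'h::ring_1 \<Rightarrow> 'h"
    and \<Delta> :: "'h \<Rightarrow> ('h, 'h, 'k) tensor"
    and \<epsilon> :: "'h \<Rightarrow> 'k"
    and S :: "'h \<Rightarrow> 'h"
    and scaleV :: "'k \<Rightarrow> 'v::ab_group_add \<Rightarrow> 'v" +
  fixes act :: "'h \<Rightarrow> 'v \<Rightarrow> 'v"
    and \<delta> :: "'v \<Rightarrow> ('h, 'v, 'k) tensor"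
  assumes act_linear_left: "Vector_Spaces.linear scale scaleV (\<lambda>h. act h v)"
    and act_linear_right: "Vector_Spaces.linear scaleV scaleV (act h)"
    and act_one: "act 1 v = v"
    and act_mult: "act (h * h') v = act h (act h' v)"
    and coact_in: "\<delta> v \<in> tensor_space scale scaleV UNIV UNIV"
    and coact_linear: "linear_form scaleV (\<lambda>v. \<delta> v f)"
    and coact_coassoc: "trilinear_form scale scale scaleV F \<Longrightarrow>
          \<delta> v (\<lambda>h u. \<Delta> h (\<lambda>h1 h2. F h1 h2 u)) = \<delta> v (\<lambda>h u. \<delta> u (\<lambda>h' u'. F h h' u'))"
    and coact_counit: "linear_form scaleV g \<Longrightarrow> \<delta> v (\<lambda>h u. \<epsilon> h * g u) = g v"
    and yetter_drinfeld: "bilinear_form scale scaleV f \<Longrightarrow>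
          \<delta> (act h v) f =
          \<Delta> h (\<lambda>h1 h'. \<Delta> h' (\<lambda>h2 h3. \<delta> v (\<lambda>g u. f (h1 * g * S h3) (act h2 u))))"

definition yd_simple ::
  "('k::field \<Rightarrow> 'h::ring_1 \<Rightarrow> 'h) \<Rightarrow> ('k \<Rightarrow> 'v::ab_group_add \<Rightarrow> 'v) \<Rightarrow>
   ('h \<Rightarrow> 'v \<Rightarrow> 'v) \<Rightarrow> ('v \<Rightarrow> ('h, 'v, 'k) tensor) \<Rightarrow> bool" where
  "yd_simple scale scaleV act \<delta> \<longleftrightarrow>
     (\<exists>v::'v. v \<noteq> 0) \<and>
     (\<forall>U. module.subspace scaleV U \<and> (\<forall>h. \<forall>u\<in>U. act h u \<in> U) \<and>
          (\<forall>u\<in>U. \<delta> u \<in> tensor_space scale scaleV UNIV U)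
        \<longrightarrow> U = {0} \<or> U = UNIV)"

text \<open>The braiding \<open>c(v \<otimes> w) = v\<^bsub>-1\<^esub> w \<otimes> v\<^sub>0\<close> of a Yetter-Drinfeld module, on \<open>V \<otimes> V\<close>.\<close>

definition yd_braiding ::
  "('k::field \<Rightarrow> 'v::ab_group_add \<Rightarrow> 'v) \<Rightarrow> ('h \<Rightarrow> 'v \<Rightarrow> 'v) \<Rightarrow> ('v \<Rightarrow> ('h, 'v, 'k) tensor) \<Rightarrow>
   ('v, 'v, 'k) tensor \<Rightarrow> ('v, 'v, 'k) tensor" where
  "yd_braiding scaleV act \<delta> t =
     (\<lambda>f. if bilinear_form scaleV scaleV f
          then t (\<lambda>v w. \<delta> v (\<lambda>h v0. f (act h w) v0)) else 0)"


section \<open>The Suzuki algebras\<close>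

datatype idx = One | Two

fun idx_val :: "idx \<Rightarrow> nat" where
  "idx_val One = 1" | "idx_val Two = 2"

text \<open>\<open>alt_prod m a b = a b a b \<dots>\<close> with \<open>m\<close> factors\<close>

fun alt_prod :: "nat \<Rightarrow> 'a::monoid_mult \<Rightarrow> 'a \<Rightarrow> 'a" where
  "alt_prod 0 a b = 1"
| "alt_prod (Suc m) a b = a * alt_prod m b a"

text \<open>
  The defining relations, as elements to be equated to zero; \<open>alt_prod m (x One Two) (x Two One)\<close>
  is \<open>\<chi>\<^sub>1\<^sub>2\<^sup>m = x\<^sub>1\<^sub>2 x\<^sub>2\<^sub>1 x\<^sub>1\<^sub>2 \<dots>\<close>, and similarly for the other \<open>\<chi>\<^bsub>ij\<^esub>\<^sup>m\<close>.
\<close>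

definition suzuki_relators ::
  "nat \<Rightarrow> nat \<Rightarrow> int \<Rightarrow> int \<Rightarrow> (idx \<Rightarrow> idx \<Rightarrow> 'a::ring_1) \<Rightarrow> 'a set" where
  "suzuki_relators N L mu lam x =
     {x One One ^ 2 - x Two Two ^ 2,
      x One Two ^ 2 - x Two One ^ 2,
      alt_prod L (x Two One) (x One Two) - of_int lam * alt_prod L (x One Two) (x Two One),
      alt_prod L (x One One) (x Two Two) - alt_prod L (x Two Two) (x One One),
      x One One ^ (2 * N) + of_int mu * x One Two ^ (2 * N) - 1} \<union>
     {x i j * x k l |i j k l. odd (idx_val i + idx_val j + idx_val k + idx_val l)}"

text \<open>
  The free algebra on \<open>x\<^sub>1\<^sub>1, x\<^sub>1\<^sub>2, x\<^sub>2\<^sub>1, x\<^sub>2\<^sub>2\<close> is the monoid algebra of the word monoid. The monoid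
  is written additively because multiplication on \<^typ>\<open>'a \<Rightarrow>\<^sub>0 'b\<close> is convolution along \<open>+\<close>.
\<close>

datatype word = Word (letters: "(idx \<times> idx) list")

instantiation word :: monoid_add
begin

definition zero_word :: word where
  "zero_word = Word []"

definition plus_word :: "word \<Rightarrow> word \<Rightarrow> word" where
  "plus_word u v = Word (letters u @ letters v)"

instance
  by standard (simp_all add: zero_word_def plus_word_def)

end

definition free_gen :: "idx \<Rightarrow> idx \<Rightarrow> word \<Rightarrow>\<^sub>0 'k::field" where
  "free_gen i j = Poly_Mapping.single (Word [(i, j)]) 1"

definition free_eval ::
  "('k::field \<Rightarrow> 'h::ring_1 \<Rightarrow> 'h) \<Rightarrow> (idx \<Rightarrow> idx \<Rightarrow> 'h) \<Rightarrow> (word \<Rightarrow>\<^sub>0 'k) \<Rightarrow> 'h" where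
  "free_eval scale x p =
     (\<Sum>w\<in>Poly_Mapping.keys p.
        scale (Poly_Mapping.lookup p w) (prod_list (map (\<lambda>(i, j). x i j) (letters w))))"

text \<open>The two-sided ideal generated by \<open>G\<close>\<close>

inductive_set gen_ideal :: "'a::ring_1 set \<Rightarrow> 'a set" for G where
  zero: "0 \<in> gen_ideal G"
| add: "\<lbrakk>g \<in> G; p \<in> gen_ideal G\<rbrakk> \<Longrightarrow> a * g * b + p \<in> gen_ideal G"

text \<open>
  The Suzuki algebra \<open>A\<close> with parameters \<open>N, L, \<mu>, \<lambda>\<close>, up to isomorphism: evaluation at the
  generators identifies the algebra with the free algebra modulo the ideal of relations.
\<close>

locale suzuki_algebra = hopf_algebra scale \<Delta> \<epsilon> S
  for scale :: "'k::field \<Rightarrow> 'h::ring_1 \<Rightarrow> 'h"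
    and \<Delta> :: "'h \<Rightarrow> ('h, 'h, 'k) tensor"
    and \<epsilon> :: "'h \<Rightarrow> 'k"
    and S :: "'h \<Rightarrow> 'h" +
  fixes x :: "idx \<Rightarrow> idx \<Rightarrow> 'h"
    and N L :: nat
    and mu lam :: int
  assumes generated: "surj (free_eval scale x)"
    and relations: "free_eval scale x p = 0 \<longleftrightarrow> p \<in> gen_ideal (suzuki_relators N L mu lam free_gen)"
    and comult_gen: "\<Delta> (x i j) f =
          tens scale scale (x i One) (x One j) f + tens scale scale (x i Two) (x Two j) f"
    and counit_gen: "\<epsilon> (x i j) = (if i = j then 1 else 0)"
    and antipode_gen: "S (x i j) = x j i ^ (4 * N - 1)"


section \<open>Set-theoretical solutions and rack type braidings\<close>

text \<open>
  In both cases below \<open>e = d1 * (2 * n + 1) + d0\<close>. For \<open>a, b \<in> {1..2 * n + 1}\<close> one has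
  \<open>d1 \<le> 2\<close> in the odd and \<open>d1 \<le> 1\<close> in the even case, and no subtraction is truncated.
\<close>

definition suzuki_solution :: "nat \<Rightarrow> nat \<times> nat \<Rightarrow> nat \<times> nat" where
  "suzuki_solution n = (\<lambda>(a, b).
     if odd (a + b) then
       (let e = b + (2 * a - 1); d1 = e div (2 * n + 1); d0 = e mod (2 * n + 1) in
        if d1 = 0 then (b + 2 * a - 1, a)
        else if d1 = 1 then (if d0 = 0 then (2 * n + 1, a) else (2 * n + 2 - d0, a))
        else (if d0 = 0 then (1, a) else (d0, a)))
     else if 2 * a - 1 < b then (b - 2 * a + 1, a)
     else
       (let e = 2 * a - 1 - b; d1 = e div (2 * n + 1); d0 = e mod (2 * n + 1) in
        if d1 = 0 then (2 * a - b, a) else (2 * n + 1 - d0, a)))"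

definition solution_isomorphic ::
  "'a set \<Rightarrow> ('a \<times> 'a \<Rightarrow> 'a \<times> 'a) \<Rightarrow> 'b set \<Rightarrow> ('b \<times> 'b \<Rightarrow> 'b \<times> 'b) \<Rightarrow> bool" where
  "solution_isomorphic X r Y r' \<longleftrightarrow>
     (\<exists>\<phi>. bij_betw \<phi> X Y \<and>
        (\<forall>a\<in>X. \<forall>b\<in>X. map_prod \<phi> \<phi> (r (a, b)) = r' (\<phi> a, \<phi> b)))"

definition indexed_basis ::
  "('k::field \<Rightarrow> 'v::ab_group_add \<Rightarrow> 'v) \<Rightarrow> 'i set \<Rightarrow> ('i \<Rightarrow> 'v) \<Rightarrow> bool" where
  "indexed_basis s X w \<longleftrightarrow>
     inj_on w X \<and> \<not> module.dependent s (w ` X) \<and> module.span s (w ` X) = UNIV"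

text \<open>\<open>c(w\<^sub>a \<otimes> w\<^sub>b) = R\<^bsub>a,b\<^esub> w\<^sub>x \<otimes> w\<^sub>y\<close> with \<open>(x, y) = r(a, b)\<close>, for a basis \<open>(w\<^sub>a)\<close> indexed by \<open>X\<close>\<close>

definition braiding_associated ::
  "('k::field \<Rightarrow> 'v::ab_group_add \<Rightarrow> 'v) \<Rightarrow> (('v, 'v, 'k) tensor \<Rightarrow> ('v, 'v, 'k) tensor) \<Rightarrow>
   'i set \<Rightarrow> ('i \<times> 'i \<Rightarrow> 'i \<times> 'i) \<Rightarrow> ('i \<Rightarrow> 'v) \<Rightarrow> ('i \<Rightarrow> 'i \<Rightarrow> 'k) \<Rightarrow> bool" where
  "braiding_associated s c X r w R \<longleftrightarrow>
     indexed_basis s X w \<and>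
     (\<forall>a\<in>X. \<forall>b\<in>X. R a b \<noteq> 0 \<and>
        c (tens s s (w a) (w b)) =
        tensor_scale (R a b) (tens s s (w (fst (r (a, b)))) (w (snd (r (a, b))))))"

text \<open>The cyclic group \<open>\<int>\<^sub>m\<close> is represented by the residues \<open>{0..<m}\<close>.\<close>

definition dihedral_op :: "nat \<Rightarrow> int \<Rightarrow> int \<Rightarrow> int" where
  "dihedral_op m i j = (2 * i - j) mod int m"

definition dihedral_solution :: "nat \<Rightarrow> int \<times> int \<Rightarrow> int \<times> int" where
  "dihedral_solution m = (\<lambda>(i, j). (dihedral_op m i j, i))"

definition dihedral_rack_type ::
  "('k::field \<Rightarrow> 'v::ab_group_add \<Rightarrow> 'v) \<Rightarrow> (('v, 'v, 'k) tensor \<Rightarrow> ('v, 'v, 'k) tensor) \<Rightarrow> nat \<Rightarrow> bool" where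
  "dihedral_rack_type s c m \<longleftrightarrow>
     (\<exists>u R'. braiding_associated s c {0..<int m} (dihedral_solution m) u R')"

end

theory Submission
  imports Defs
begin

text \<open>
  Put \<open>m = 2n + 1\<close>. The solution \<open>(X, r)\<close> is the dihedral rack in folded form. Fold \<open>\<int>/2m\<close> along
  the reflection \<open>k \<mapsto> 1 - k\<close>: each class \<open>{k, 1 - k}\<close> has exactly one representative in
  \<open>{1, \<dots>, m}\<close>, and the case distinctions in \<open>r\<close> only compute this representative, the first
  component of \<open>r(a, b)\<close> being the class of \<open>b + (2a - 1)\<close> if \<open>a + b\<close> is odd and of
  \<open>b - (2a - 1)\<close> if \<open>a + b\<close> is even. Since \<open>k\<close> and \<open>1 - k\<close> have different parities, each class
  also has exactly one odd representative modulo \<open>2m\<close>: for \<open>a \<in> {1, \<dots>, m}\<close> it is \<open>a\<close> if \<open>a\<close>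
  is odd and \<open>1 - a\<close> if \<open>a\<close> is even. In terms of odd representatives \<open>i\<close>, \<open>j\<close> of \<open>a\<close>, \<open>b\<close> the
  first component of \<open>r(a, b)\<close> is \<open>2i - j\<close> in all four parity cases
  (\<open>odd_rep_suzuki_solution\<close>). As \<open>m\<close> is odd, reduction modulo \<open>m\<close> is injective on the odd
  classes modulo \<open>2m\<close>, which gives the isomorphism with \<open>\<int>\<^sub>m\<close> (\<open>bij_betw_odd_rep\<close>).

  The statement on the braiding follows by reindexing the basis along this bijection
  (\<open>braiding_associated_transport\<close>).
\<close>

text \<open>The odd member of the pair \<open>{a, 1 - a}\<close>.\<close>

definition odd_rep :: "nat \<Rightarrow> int" where
  "odd_rep a = (if odd a then int a else 1 - int a)"

lemma div_mod_second_block: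
  fixes e m :: nat
  assumes "m \<le> e" "e < 2 * m"
  shows "e div m = 1" "e mod m = e - m"
proof -
  show "e div m = 1"
    using assms by (intro div_nat_eqI) simp_all
  then show "e mod m = e - m"
    by (simp add: modulo_nat_def)
qed

lemma div_mod_third_block:
  fixes e m :: nat
  assumes "2 * m \<le> e" "e < 3 * m"
  shows "e div m = 2" "e mod m = e - 2 * m"
proof -
  show "e div m = 2"
    using assms by (intro div_nat_eqI) simp_all
  then show "e mod m = e - 2 * m"
    by (simp add: modulo_nat_def)
qed

text \<open>
  Explicit form of \<open>r\<close>: the first component is the representative in \<open>{1, \<dots>, m}\<close> of \<open>e\<close>, modulo
  \<open>2m\<close> and up to \<open>k \<mapsto> 1 - k\<close>; in the next lemma that of \<open>b + 1 - 2a\<close>.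
\<close>

lemma suzuki_solution_odd:
  assumes ab: "a \<in> {1..2 * n + 1}" "b \<in> {1..2 * n + 1}" and odd: "odd (a + b)"
  defines "m \<equiv> 2 * n + 1" and "e \<equiv> b + (2 * a - 1)"
  shows "suzuki_solution n (a, b) =
    (if e \<le> m then e else if e \<le> 2 * m then 2 * m + 1 - e else e - 2 * m, a)"
proof -
  have bound: "e < 3 * m"
    using ab unfolding m_def e_def by auto
  have "b + 2 * a - 1 = e"
    using ab by (auto simp: e_def)
  then have sol: "suzuki_solution n (a, b) =
      (if e div m = 0 then e
       else if e div m = 1 then (if e mod m = 0 then m else m + 1 - e mod m)
       else (if e mod m = 0 then 1 else e mod m), a)"
    using odd unfolding suzuki_solution_def Let_def e_def m_def by simp
  consider "e < m" | "m \<le> e" "e < 2 * m" | "2 * m \<le> e" by linarith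
  then show ?thesis
  proof cases
    case 1
    then show ?thesis unfolding sol by simp
  next
    case 2
    then show ?thesis
      unfolding sol div_mod_second_block[OF 2] by auto
  next
    case 3
    then show ?thesis
      unfolding sol div_mod_third_block[OF 3 bound] by (auto simp: m_def)
  qed
qed

lemma suzuki_solution_even:
  assumes ab: "a \<in> {1..2 * n + 1}" "b \<in> {1..2 * n + 1}" and even: "even (a + b)"
  defines "m \<equiv> 2 * n + 1"
  shows "suzuki_solution n (a, b) =
    (if 2 * a \<le> b then b + 1 - 2 * a else if 2 * a \<le> b + m then 2 * a - b
     else 2 * m + b - 2 * a + 1, a)"
proof -
  let ?e = "2 * a - 1 - b"
  have sol: "suzuki_solution n (a, b) =
      (if 2 * a \<le> b then b + 1 - 2 * a
       else if ?e div m = 0 then 2 * a - b else m - ?e mod m, a)"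
    using even ab unfolding suzuki_solution_def Let_def m_def by auto
  consider "2 * a \<le> b" | "b < 2 * a" "?e < m" | "b < 2 * a" "m \<le> ?e" by linarith
  then show ?thesis
  proof cases
    case 1
    then show ?thesis unfolding sol by simp
  next
    case 2
    then have "2 * a \<le> b + m" by linarith
    with 2 show ?thesis unfolding sol by simp
  next
    case 3
    have "?e < 2 * m"
      using ab unfolding m_def by auto
    note block = div_mod_second_block[OF 3(2) this]
    have "b + m < 2 * a"
      using 3 ab unfolding m_def by auto
    then show ?thesis
      unfolding sol block using 3 \<open>?e < 2 * m\<close> by auto
  qed
qed

text \<open>On odd representatives the solution is the dihedral operation, modulo \<open>2(2n + 1)\<close>.\<close>

lemma odd_rep_suzuki_solution:
  assumes ab: "a \<in> {1..2 * n + 1}" "b \<in> {1..2 * n + 1}"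
  shows "\<exists>t. odd_rep (fst (suzuki_solution n (a, b))) =
    2 * odd_rep a - odd_rep b + t * (2 * int (2 * n + 1))"
proof (cases "odd (a + b)")
  case True
  define m where "m = 2 * n + 1"
  define e where "e = b + (2 * a - 1)"
  have e: "int e = int b + 2 * int a - 1"
    using ab by (auto simp: e_def)
  have sol: "fst (suzuki_solution n (a, b)) =
      (if e \<le> m then e else if e \<le> 2 * m then 2 * m + 1 - e else e - 2 * m)"
    using suzuki_solution_odd[OF ab True] by (simp add: m_def e_def)
  have parity: "odd a = odd e" "odd b = even e"
    using True e by (presburger, presburger)
  consider "e \<le> m" | "m < e" "e \<le> 2 * m" | "2 * m < e" by linarith
  \<comment> \<open>the parities decide between \<open>k\<close> and \<open>1 - k\<close> on both sides; folding costs at most one period\<close>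
  then have "\<exists>t\<in>{-1, 0, 1}. odd_rep (fst (suzuki_solution n (a, b))) =
      2 * odd_rep a - odd_rep b + t * (2 * int m)"
    using e parity unfolding sol odd_rep_def by cases auto
  then show ?thesis unfolding m_def by blast
next
  case False
  define m where "m = 2 * n + 1"
  have even: "even (a + b)" using False by simp
  have sol: "fst (suzuki_solution n (a, b)) =
      (if 2 * a \<le> b then b + 1 - 2 * a else if 2 * a \<le> b + m then 2 * a - b
       else 2 * m + b - 2 * a + 1)"
    using suzuki_solution_even[OF ab even] by (simp add: m_def)
  have parity: "odd b = odd a"
    using even by auto
  have "2 * a \<le> 2 * m" using ab by (auto simp: m_def)
  consider "2 * a \<le> b" | "b < 2 * a" "2 * a \<le> b + m" | "b + m < 2 * a" by linarith
  then have "\<exists>t\<in>{-1, 0, 1}. odd_rep (fst (suzuki_solution n (a, b))) =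
      2 * odd_rep a - odd_rep b + t * (2 * int m)"
    using parity \<open>2 * a \<le> 2 * m\<close> unfolding sol odd_rep_def by cases auto
  then show ?thesis unfolding m_def by blast
qed

lemma bij_betw_odd_rep:
  "bij_betw (\<lambda>a. odd_rep a mod int (2 * n + 1)) {1..2 * n + 1} {0..<int (2 * n + 1)}"
proof -
  let ?m = "int (2 * n + 1)"
  let ?f = "\<lambda>a. odd_rep a mod ?m"
  have inj: "inj_on ?f {1..2 * n + 1}"
  proof (rule inj_onI)
    fix a b assume ab: "a \<in> {1..2 * n + 1}" "b \<in> {1..2 * n + 1}" and "?f a = ?f b"
    then have "?m dvd odd_rep a - odd_rep b"
      by (simp only: mod_eq_dvd_iff)
    moreover have "even (odd_rep a - odd_rep b)"
      by (simp add: odd_rep_def)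
    moreover have "coprime 2 ?m"
      by simp
    ultimately have "2 * ?m dvd odd_rep a - odd_rep b"
      by (intro divides_mult) auto
    \<comment> \<open>both representatives lie in \<open>{1 - m, \<dots>, m}\<close>, \<open>2m\<close> consecutive integers\<close>
    moreover have "\<bar>odd_rep a - odd_rep b\<bar> < 2 * ?m"
      using ab by (auto simp: odd_rep_def)
    ultimately have "odd_rep a = odd_rep b"
      using dvd_imp_le_int[of "odd_rep a - odd_rep b" "2 * ?m"] by force
    then show "a = b"
      using ab by (auto simp: odd_rep_def split: if_splits)
  qed
  have "?f ` {1..2 * n + 1} = {0..<?m}"
  proof (rule card_subset_eq)
    show "?f ` {1..2 * n + 1} \<subseteq> {0..<?m}"
      by auto
    show "card (?f ` {1..2 * n + 1}) = card {0..<?m}"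
      using inj by (simp add: card_image)
  qed simp
  with inj show ?thesis
    by (simp add: bij_betw_def)
qed

lemma suzuki_solution_isomorphic_dihedral:
  "solution_isomorphic {1..2 * n + 1} (suzuki_solution n)
     {0..<int (2 * n + 1)} (dihedral_solution (2 * n + 1))"
proof -
  let ?m = "int (2 * n + 1)"
  let ?f = "\<lambda>a. odd_rep a mod ?m"
  have "map_prod ?f ?f (suzuki_solution n (a, b)) = dihedral_solution (2 * n + 1) (?f a, ?f b)"
    if ab: "a \<in> {1..2 * n + 1}" "b \<in> {1..2 * n + 1}" for a b
  proof -
    obtain t where t: "odd_rep (fst (suzuki_solution n (a, b))) =
        2 * odd_rep a - odd_rep b + t * (2 * ?m)"
      using odd_rep_suzuki_solution[OF ab] by blast
    have "?f (fst (suzuki_solution n (a, b))) = (2 * odd_rep a - odd_rep b + (2 * t) * ?m) mod ?m"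
      unfolding t by (simp only: ac_simps)
    also have "\<dots> = (2 * odd_rep a - odd_rep b) mod ?m"
      by (rule mod_mult_self1)
    also have "\<dots> = (2 * ?f a - ?f b) mod ?m"
      by (simp only: mod_diff_eq[symmetric, of "2 * _"] mod_mult_right_eq mod_mod_trivial)
    finally have "?f (fst (suzuki_solution n (a, b))) = dihedral_op (2 * n + 1) (?f a) (?f b)"
      by (simp only: dihedral_op_def)
    moreover have "snd (suzuki_solution n (a, b)) = a"
      using suzuki_solution_odd[OF ab] suzuki_solution_even[OF ab]
      by (cases "odd (a + b)") simp_all
    ultimately show ?thesis
      by (simp add: dihedral_solution_def map_prod_def split_beta)
  qed
  then show ?thesis
    using bij_betw_odd_rep[of n] unfolding solution_isomorphic_def by blast
qed

text \<open>
  Reindexing the basis along an isomorphism of solutions. The map \<open>r\<close> has to preserve \<open>X \<times> X\<close>,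
  as \<open>\<phi>\<close> is only known to be invertible on \<open>X\<close>.
\<close>

lemma braiding_associated_transport:
  assumes iso: "solution_isomorphic X r Y r'"
    and closed: "\<And>a b. a \<in> X \<Longrightarrow> b \<in> X \<Longrightarrow> r (a, b) \<in> X \<times> X"
    and assoc: "braiding_associated s c X r w R"
  shows "\<exists>u R'. braiding_associated s c Y r' u R'"
proof -
  obtain \<phi> where bij: "bij_betw \<phi> X Y"
    and hom: "\<And>a b. a \<in> X \<Longrightarrow> b \<in> X \<Longrightarrow> map_prod \<phi> \<phi> (r (a, b)) = r' (\<phi> a, \<phi> b)"
    using iso unfolding solution_isomorphic_def by blast
  define \<psi> where "\<psi> = inv_into X \<phi>"
  have bij': "bij_betw \<psi> Y X"
    unfolding \<psi>_def by (rule bij_betw_inv_into[OF bij])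
  have inv: "\<psi> (\<phi> a) = a" if "a \<in> X" for a
    using bij that unfolding \<psi>_def by (rule bij_betw_inv_into_left)
  have img: "(w \<circ> \<psi>) ` Y = w ` X"
    using bij' by (simp add: bij_betw_def flip: image_image)
  have "indexed_basis s Y (w \<circ> \<psi>)"
    using assoc bij' unfolding braiding_associated_def indexed_basis_def img
    by (auto simp: bij_betw_def intro!: comp_inj_on)
  moreover have "R (\<psi> i) (\<psi> j) \<noteq> 0 \<and>
      c (tens s s ((w \<circ> \<psi>) i) ((w \<circ> \<psi>) j)) =
      tensor_scale (R (\<psi> i) (\<psi> j))
        (tens s s ((w \<circ> \<psi>) (fst (r' (i, j)))) ((w \<circ> \<psi>) (snd (r' (i, j)))))"
    if ij: "i \<in> Y" "j \<in> Y" for i j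
  proof -
    obtain a b where a: "a \<in> X" "i = \<phi> a" and b: "b \<in> X" "j = \<phi> b"
      using ij bij unfolding bij_betw_def by blast
    obtain y z where r: "r (a, b) = (y, z)" "y \<in> X" "z \<in> X"
      using closed[OF a(1) b(1)] by blast
    have "r' (i, j) = (\<phi> y, \<phi> z)"
      using hom[OF a(1) b(1)] a b r by simp
    then show ?thesis
      using assoc a b r unfolding braiding_associated_def by (auto simp: inv)
  qed
  ultimately show ?thesis
    unfolding braiding_associated_def by (intro exI[of _ "w \<circ> \<psi>"]
        exI[of _ "\<lambda>i j. R (\<psi> i) (\<psi> j)"]) blast
qed

lemma suzuki_solution_closed:
  assumes ab: "a \<in> {1..2 * n + 1}" "b \<in> {1..2 * n + 1}"
  shows "suzuki_solution n (a, b) \<in> {1..2 * n + 1} \<times> {1..2 * n + 1}"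
proof (cases "odd (a + b)")
  case True
  show ?thesis
    using ab unfolding suzuki_solution_odd[OF ab True] by auto
next
  case False
  then have "even (a + b)" by simp
  show ?thesis
    using ab unfolding suzuki_solution_even[OF ab \<open>even (a + b)\<close>] by auto
qed

theorem lemma3p10:
  fixes N n :: nat and mu lam :: int
    and scale :: "'k::{alg_closed_field, field_char_0} \<Rightarrow> 'h::ring_1 \<Rightarrow> 'h"
    and \<Delta> :: "'h \<Rightarrow> ('h, 'h, 'k) tensor"
    and \<epsilon> :: "'h \<Rightarrow> 'k"
    and S :: "'h \<Rightarrow> 'h"
    and x :: "idx \<Rightarrow> idx \<Rightarrow> 'h"
    and scaleV :: "'k \<Rightarrow> 'v::ab_group_add \<Rightarrow> 'v"
    and act :: "'h \<Rightarrow> 'v \<Rightarrow> 'v"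
    and \<delta> :: "'v \<Rightarrow> ('h, 'v, 'k) tensor"
    and w :: "nat \<Rightarrow> 'v"
    and R :: "nat \<Rightarrow> nat \<Rightarrow> 'k"
  assumes "N \<ge> 1" and "n \<ge> 1" and "mu \<in> {1, -1}" and "lam \<in> {1, -1}"
    and "suzuki_algebra scale \<Delta> \<epsilon> S x N (2 * n + 1) mu lam"
    and "yetter_drinfeld_module scale \<Delta> \<epsilon> S scaleV act \<delta>"
    and "yd_simple scale scaleV act \<delta>"
    and "braiding_associated scaleV (yd_braiding scaleV act \<delta>)
           {1..2 * n + 1} (suzuki_solution n) w R"
  shows "solution_isomorphic {1..2 * n + 1} (suzuki_solution n)
           {0..<int (2 * n + 1)} (dihedral_solution (2 * n + 1)) \<and>
         dihedral_rack_type scaleV (yd_braiding scaleV act \<delta>) (2 * n + 1)"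
proof
  show iso: "solution_isomorphic {1..2 * n + 1} (suzuki_solution n)
      {0..<int (2 * n + 1)} (dihedral_solution (2 * n + 1))"
    by (rule suzuki_solution_isomorphic_dihedral)
  show "dihedral_rack_type scaleV (yd_braiding scaleV act \<delta>) (2 * n + 1)"
    unfolding dihedral_rack_type_def
    by (rule braiding_associated_transport[OF iso suzuki_solution_closed assms(8)])
qed

end
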